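(* Let $\nu\in\mathbb R$ with $\nu+2>0$ and let $x\in(0,2)$. Then $$\mathbf L_\nu(x)-\sqrt{\frac{2x}{\pi}}\,I_{\nu+\frac12}(x)=\int_1^\infty\frac{\partial}{\partial u}\Big(\Gamma(u+\nu+1)\,I_{u+\nu+\frac12}(x)\Big)\left(\int_0^{[u]}\mathfrak d_s\left(\frac{\beta(s)}{\Gamma(s+\nu+1)}\right)\mathrm ds\right)\mathrm du,$$ where $$\beta(s)=-\sqrt{\frac{x}{2\pi}}\,\frac{e^{\mathrm i\pi s}\left(\frac x2\right)^s}{\Gamma(s+1)\left(s+\frac12\right)}.$$
   Context: $I_\nu(x)=\sum_{n\ge0}\frac{(x/2)^{2n+\nu}}{\Gamma(n+\nu+1)\,n!}$ is the modified Bessel function of the first kind and $\mathbf L_\nu(x)=\sum_{n\ge0}\frac{(x/2)^{2n+\nu+1}}{\Gamma(n+\frac32)\Gamma(n+\nu+\frac32)}$ is the modified Struve function, where $1/\Gamma$ is understood as an entire function. $[x]$ and $\{x\}=x-[x]$ denote the integer and fractional part of a real number $x$. The operator $\mathfrak d_s$ is $\mathfrak d_s=1+\{s\}\frac{\mathrm d}{\mathrm ds}$, i.e. $\mathfrak d_s f(s)=f(s)+\{s\}f'(s)$, with $x$ held fixed. *)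

theory Defs
  imports "HOL-Analysis.Analysis"
begin

(* Power series with real order, intended for arguments x > 0 (powr is the real power there).
   The entire function 1/Gamma is rGamma, so that nonpositive integer arguments give 0. *)

definition bessel_I :: "real \<Rightarrow> real \<Rightarrow> real" where
  "bessel_I \<nu> x =
     (\<Sum>n. (x / 2) powr (2 * real n + \<nu>) * rGamma (real n + \<nu> + 1) / fact n)"

definition struve_L :: "real \<Rightarrow> real \<Rightarrow> real" where
  "struve_L \<nu> x =
     (\<Sum>n. (x / 2) powr (2 * real n + \<nu> + 1) *
           rGamma (real n + 3 / 2) * rGamma (real n + \<nu> + 3 / 2))"

(* The operator 1 + {s} d/ds, for vector-valued functions of a real variable. *)
definition frac_diff_op :: "(real \<Rightarrow> 'a::real_normed_vector) \<Rightarrow> real \<Rightarrow> 'a" where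
  "frac_diff_op f s = f s + frac s *\<^sub>R vector_derivative f (at s)"

definition struve_beta :: "real \<Rightarrow> real \<Rightarrow> complex" where
  "struve_beta x s =
     - (of_real (sqrt (x / (2 * pi))) *
        (exp (\<i> * of_real pi * of_real s) * of_real ((x / 2) powr s) *
         of_real (rGamma (s + 1)) / of_real (s + 1 / 2)))"

end

theory Submission imports Defs "HOL-Complex_Analysis.Complex_Analysis"
begin

text \<open>
  Integrating $(s - k)a(s)$ by parts on $[k, k+1]$ shows that the inner integral is the partial sum
  $\sum_{1 \le k \le [u]} a(k)$. The function
  $g(u) = \Gamma(u+\nu+1) I_{u+\nu+1/2}(x)$ decreases to $0$ (here $x < 2$ is used), so
  Fubini turns the outer integral into $-\sum_{k \ge 1} a(k) g(k)$. By
  $\sum_{k \le m} (-1)^k \binom{m}{k} / (k + \frac12) = m! / (\frac12)_{m+1}$, rearranging the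
  double series gives
  $\mathbf{L}_\nu(x) = \sqrt{x/2\pi} \sum_{k \ge 0} (-1)^k (x/2)^k / (k!\,(k+\frac12))\, I_{k+\nu+1/2}(x)$,
  whose term $k = 0$ is the Bessel function on the left and whose other terms are $-a(k) g(k)$.
\<close>

section \<open>Finite alternating sums with a shifted denominator\<close>

text \<open>This is the partial fraction expansion of m! / (a (a+1) ... (a+m)). Pascal's rule makes
  the sum for m+1 at a equal to the sum for m at a minus the sum for m at a+1, so the induction on m
  has to leave a arbitrary.\<close>

lemma alternating_choose_sum_over_shift:
  fixes a :: real
  assumes "a > 0"
  shows "(\<Sum>k\<le>m. (-1) ^ k * real (m choose k) / (real k + a)) = fact m / pochhammer a (Suc m)"
  using assms
proof (induction m arbitrary: a)
  case 0
  then show ?case by simp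
next
  case (Suc m)
  have "(\<Sum>k\<le>Suc m. (-1) ^ k * real (Suc m choose k) / (real k + a))
      = 1 / a + (\<Sum>k\<le>m. (-1) ^ Suc k * real (Suc m choose Suc k) / (real (Suc k) + a))"
    by (subst sum.atMost_Suc_shift) simp
  also have "\<dots> = 1 / a + (\<Sum>k\<le>m. (-1) ^ Suc k * real (m choose Suc k) / (real (Suc k) + a))
      - (\<Sum>k\<le>m. (-1) ^ k * real (m choose k) / (real k + (a + 1)))"
  proof -
    have "(-1) ^ Suc k * real (Suc m choose Suc k) / (real (Suc k) + a) =
        (-1) ^ Suc k * real (m choose Suc k) / (real (Suc k) + a) -
        (-1) ^ k * real (m choose k) / (real k + (a + 1))" for k
      by (simp add: add_divide_distrib diff_divide_distrib algebra_simps)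
    then show ?thesis by (simp only: sum_subtractf)
  qed
  \<comment> \<open>The isolated 1/a is the missing term of index 0. The top index Suc m adds
    nothing because m choose Suc m is 0.\<close>
  also have "1 / a + (\<Sum>k\<le>m. (-1) ^ Suc k * real (m choose Suc k) / (real (Suc k) + a))
      = (\<Sum>k\<le>Suc m. (-1) ^ k * real (m choose k) / (real k + a))"
    by (subst sum.atMost_Suc_shift) simp
  also have "\<dots> = (\<Sum>k\<le>m. (-1) ^ k * real (m choose k) / (real k + a))"
    by simp
  also have "\<dots> - (\<Sum>k\<le>m. (-1) ^ k * real (m choose k) / (real k + (a + 1)))
      = fact m / pochhammer a (Suc m) - fact m / pochhammer (a + 1) (Suc m)"
    using Suc.IH [of a] Suc.IH [of "a + 1"] Suc.prems by simp
  also have "\<dots> = fact (Suc m) / pochhammer a (Suc (Suc m))"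
  proof -
    have p: "pochhammer (a + 1) m > 0"
      using Suc.prems by (intro pochhammer_pos) auto
    have "pochhammer a (Suc m) = a * pochhammer (a + 1) m"
      by (rule pochhammer_rec)
    moreover have "pochhammer (a + 1) (Suc m) = pochhammer (a + 1) m * (a + 1 + real m)"
      by (simp add: pochhammer_Suc)
    moreover have "pochhammer a (Suc (Suc m)) = a * (pochhammer (a + 1) m * (a + 1 + real m))"
      by (subst pochhammer_rec) (simp add: pochhammer_Suc)
    moreover have "a + 1 + real m > 0" using Suc.prems by simp
    ultimately show ?thesis
      using p Suc.prems by (simp add: divide_simps) (simp add: algebra_simps)
  qed
  finally show ?case .
qed

text \<open>The left side is the coefficient that appears on the diagonal k + n = m of the double
  series below. Taking a = 1/2 turns the Pochhammer symbol into Gamma(m + 3/2) / Gamma(1/2), and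
  Gamma(1/2) is the square root of pi.\<close>

lemma alternating_factorial_sum_half:
  "(\<Sum>k\<le>m. (-1) ^ k / (fact k * fact (m - k) * (real k + 1 / 2))) = sqrt pi * rGamma (real m + 3 / 2)"
proof -
  have "(\<Sum>k\<le>m. (-1) ^ k / (fact k * fact (m - k) * (real k + 1 / 2)))
      = (\<Sum>k\<le>m. (-1) ^ k * real (m choose k) / (real k + 1 / 2)) / fact m"
    unfolding sum_divide_distrib
    by (rule sum.cong) (auto simp: binomial_fact)
  also have "\<dots> = 1 / pochhammer (1 / 2) (Suc m)"
    by (subst alternating_choose_sum_over_shift) auto
  also have "\<dots> = sqrt pi * rGamma (real m + 3 / 2)"
  proof -
    have "rGamma (1 / 2 :: real) = pochhammer (1 / 2) (Suc m) * rGamma (1 / 2 + real (Suc m))"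
      by (rule pochhammer_rGamma)
    moreover have "rGamma (1 / 2 :: real) = 1 / sqrt pi"
      by (simp add: rGamma_inverse_Gamma Gamma_one_half_real field_simps)
    moreover have "pochhammer (1 / 2 :: real) (Suc m) > 0"
      by (intro pochhammer_pos) auto
    moreover have "1 / 2 + real (Suc m) = real m + 3 / 2" by simp
    ultimately show ?thesis by (simp add: field_simps)
  qed
  finally show ?thesis .
qed

section \<open>Expansion of the modified Struve function in modified Bessel functions\<close>

text \<open>Once t >= 1, rGamma(t + 1) = rGamma(t) / t cannot grow in absolute value, so only
  finitely many initial values matter; their sum of absolute values serves as \<open>K\<close>. This
  controls the Gamma factor of the double series at every real order, including the poles of
  Gamma.\<close>

lemma rGamma_shift_bounded:
  fixes w :: real
  shows "\<exists>K. \<forall>m. \<bar>rGamma (real m + w)\<bar> \<le> K"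
proof -
  obtain M where M: "real M \<ge> 1 - w" using real_arch_simple by blast
  have dec: "\<bar>rGamma (real (M + n) + w)\<bar> \<le> \<bar>rGamma (real M + w)\<bar>" for n
  proof (induction n)
    case (Suc n)
    let ?t = "real (M + n) + w"
    have t: "?t \<ge> 1" using M by simp
    have "\<bar>rGamma (?t + 1)\<bar> \<le> ?t * \<bar>rGamma (?t + 1)\<bar>"
      using t by (simp add: mult_le_cancel_right1)
    also have "\<dots> = \<bar>rGamma ?t\<bar>"
      using rGamma_plus1 [of ?t] t by (metis abs_mult abs_of_nonneg order_trans zero_le_one)
    finally show ?case using Suc by (simp add: add_ac)
  qed simp
  show ?thesis
  proof (intro exI allI)
    fix m
    show "\<bar>rGamma (real m + w)\<bar> \<le> (\<Sum>i\<le>M. \<bar>rGamma (real i + w)\<bar>)"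
    proof (cases "m \<le> M")
      case True
      then show ?thesis by (intro member_le_sum) auto
    next
      case False
      then obtain n where "m = M + n" using le_Suc_ex nat_le_linear by blast
      then have "\<bar>rGamma (real m + w)\<bar> \<le> \<bar>rGamma (real M + w)\<bar>" using dec by simp
      also have "\<dots> \<le> (\<Sum>i\<le>M. \<bar>rGamma (real i + w)\<bar>)" by (intro member_le_sum) auto
      finally show ?thesis .
    qed
  qed
qed

text \<open>Inserting the power series of each Bessel function gives an absolutely convergent double
  series \<open>F\<close>. Its rows sum to \<open>t k\<close> and its diagonals are the terms of the
  Struve series. The absolute summability of \<open>t\<close> is what later justifies exchanging the
  sum with the outer integral.\<close>

lemma struve_L_bessel_I_series:
  fixes x \<nu> :: real
  assumes x: "0 < x"
  defines "t \<equiv> \<lambda>k. sqrt (x / (2 * pi)) * (-1) ^ k * (x / 2) ^ k / (fact k * (real k + 1 / 2)) *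
                     bessel_I (real k + \<nu> + 1 / 2) x"
  shows "t sums struve_L \<nu> x" and "summable (\<lambda>k. \<bar>t k\<bar>)"
proof -
  define y where "y = x / 2"
  have y: "y > 0" using x by (simp add: y_def)
  define c where "c = sqrt (x / (2 * pi)) * y powr (\<nu> + 1 / 2)"
  \<comment> \<open>The factor y^k of the coefficient and y^(2n+k) of the Bessel series merge into
    y^(2(k+n)). The power of y and the reciprocal Gamma factor then depend on k + n alone, so both
    are constant along a diagonal.\<close>
  define F where "F = (\<lambda>(k, n). c * (-1) ^ k / (real k + 1 / 2) * (y\<^sup>2) ^ (k + n) *
     rGamma (real (k + n) + (\<nu> + 3 / 2)) / (fact k * fact n))"
  obtain K where K: "\<bar>rGamma (real m + (\<nu> + 3 / 2))\<bar> \<le> K" for m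
    using rGamma_shift_bounded [of "\<nu> + 3 / 2"] by blast
  have c0: "c \<ge> 0" using x by (simp add: c_def)
  have K0: "K \<ge> 0" using K [of 0] by linarith
  have E: "((\<lambda>n. (y\<^sup>2) ^ n / fact n) has_sum exp (y\<^sup>2)) UNIV"
    using exp_converges [of "y\<^sup>2"]
    by (intro sums_nonneg_imp_has_sum) (auto simp: field_simps scaleR_conv_of_real)
  have "(\<lambda>(k, n). (y\<^sup>2) ^ k / fact k * ((y\<^sup>2) ^ n / fact n)) summable_on (UNIV \<times> UNIV)"
    by (rule summable_on_SigmaI [where g = "\<lambda>k. (y\<^sup>2) ^ k / fact k * exp (y\<^sup>2)"])
       (simp_all only: case_prod_conv has_sum_cmult_right [OF E]
         summable_on_cmult_left [OF has_sum_imp_summable [OF E]], simp)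
  then have "(\<lambda>p. (2 * c * K) * (case p of (k, n) \<Rightarrow> (y\<^sup>2) ^ k / fact k * ((y\<^sup>2) ^ n / fact n)))
      summable_on (UNIV \<times> UNIV)"
    by (rule summable_on_cmult_right)
  \<comment> \<open>The majorant is a product of two exponential series. In its constant, 2 bounds
    1/(k + 1/2) and \<open>K\<close> bounds the reciprocal Gamma factor.\<close>
  moreover have "norm (F p) \<le> 2 * c * K * (case p of (k, n) \<Rightarrow> (y\<^sup>2) ^ k / fact k * ((y\<^sup>2) ^ n / fact n))"
    for p
  proof -
    obtain k n where p: "p = (k, n)" by fastforce
    have "1 / (real k + 1 / 2) \<le> 2" by (simp add: field_simps)
    then have "c * (1 / (real k + 1 / 2)) * \<bar>rGamma (real (k + n) + (\<nu> + 3 / 2))\<bar> \<le> c * 2 * K"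
      using c0 K0 K [of "k + n"] by (intro mult_mono) auto
    then have "(c * (1 / (real k + 1 / 2)) * \<bar>rGamma (real (k + n) + (\<nu> + 3 / 2))\<bar>) *
        ((y\<^sup>2) ^ (k + n) / (fact k * fact n)) \<le> (c * 2 * K) * ((y\<^sup>2) ^ (k + n) / (fact k * fact n))"
      by (intro mult_right_mono) auto
    then show ?thesis
      using c0 by (simp add: p F_def abs_mult power_add field_simps)
  qed
  ultimately have abs: "(\<lambda>p. norm (F p)) summable_on (UNIV \<times> UNIV)"
    by (intro Infinite_Sum.abs_summable_on_comparison_test') auto
  then have sumF: "F summable_on (UNIV \<times> UNIV)"
    by (rule Infinite_Sum.abs_summable_summable)
  have row: "((\<lambda>n. F (k, n)) has_sum t k) UNIV" for k
  proof -
    let ?d = "sqrt (x / (2 * pi)) * (-1) ^ k * (x / 2) ^ k / (fact k * (real k + 1 / 2))"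
    have "(\<lambda>n. F (k, n)) = (\<lambda>n. ?d * (y powr (2 * real n + (real k + \<nu> + 1 / 2)) *
            rGamma (real n + (real k + \<nu> + 1 / 2) + 1) / fact n))" (is "_ = (\<lambda>n. ?d * ?b n)")
    proof
      fix n
      have "y powr (2 * real n + (real k + \<nu> + 1 / 2)) =
            y powr (real (2 * n)) * y powr real k * y powr (\<nu> + 1 / 2)"
        by (simp add: powr_add [symmetric] add_ac)
      also have "\<dots> = (y\<^sup>2) ^ n * y ^ k * y powr (\<nu> + 1 / 2)"
        using y by (simp only: powr_realpow power_mult)
      finally have 1: "y powr (2 * real n + (real k + \<nu> + 1 / 2)) = (y\<^sup>2) ^ n * y ^ k * y powr (\<nu> + 1 / 2)" .
      have 2: "real n + (real k + \<nu> + 1 / 2) + 1 = real (k + n) + (\<nu> + 3 / 2)" by simp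
      have 3: "(y\<^sup>2) ^ k = y ^ k * y ^ k"
        by (metis power_even_eq power2_eq_square power_mult)
      show "F (k, n) = ?d * ?b n"
        unfolding 1 2 by (simp add: F_def c_def y_def [symmetric] power_add 3 mult_ac)
    qed
    moreover have nF: "summable (\<lambda>n. norm (F (k, n)))"
      using abs Infinite_Sum.abs_summable_on_Sigma_iff [of F UNIV "\<lambda>_. UNIV"]
      by (auto dest: summable_on_imp_summable)
    moreover have "?d \<noteq> 0" using x by auto
    ultimately have "summable (\<lambda>n. ?d * ?b n)"
      by (metis summable_norm_cancel)
    \<comment> \<open>\<open>bessel_I\<close> is a \<open>suminf\<close>, which has the intended
      value only if its series converges. Convergence of \<open>?b\<close> is inherited from the row
      of \<open>F\<close> by cancelling the nonzero factor \<open>?d\<close>.\<close>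
    then have "summable ?b"
      by (subst (asm) summable_cmult_iff) (use \<open>?d \<noteq> 0\<close> in auto)
    then have "(\<lambda>n. ?d * ?b n) sums t k"
      unfolding t_def bessel_I_def y_def by (intro sums_mult summable_sums)
    then have "(\<lambda>n. F (k, n)) sums t k"
      using \<open>(\<lambda>n. F (k, n)) = (\<lambda>n. ?d * ?b n)\<close> by simp
    then show ?thesis using nF by (intro norm_summable_imp_has_sum)
  qed
  have tot: "(t has_sum infsum F (UNIV \<times> UNIV)) UNIV"
    by (rule has_sum_SigmaD [OF has_sum_infsum [OF sumF] row])
  then have tsums: "t sums infsum F (UNIV \<times> UNIV)"
    by (rule has_sum_imp_sums)
  have "t summable_on UNIV" using tot by (rule has_sum_imp_summable)
  then show "summable (\<lambda>k. \<bar>t k\<bar>)"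
    using summable_on_iff_abs_summable_on_real summable_on_imp_summable by fastforce
  \<comment> \<open>Regrouping by diagonals: the pair (k, n) corresponds to (m, k) with m = k + n,
    where k runs over 0..m.\<close>
  have "((\<lambda>(m, k). F (k, m - k)) has_sum infsum F (UNIV \<times> UNIV)) (Sigma UNIV (\<lambda>m. {..m})) \<longleftrightarrow>
     (F has_sum infsum F (UNIV \<times> UNIV)) (UNIV \<times> UNIV)"
    by (rule has_sum_reindex_bij_witness [where i = "\<lambda>(k, n). (k + n, k)" and j = "\<lambda>(m, k). (k, m - k)"])
       auto
  then have "((\<lambda>(m, k). F (k, m - k)) has_sum infsum F (UNIV \<times> UNIV)) (Sigma UNIV (\<lambda>m. {..m}))"
    using has_sum_infsum [OF sumF] by simp
  then have "((\<lambda>m. \<Sum>k\<le>m. F (k, m - k)) has_sum infsum F (UNIV \<times> UNIV)) UNIV"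
    by (rule has_sum_SigmaD) (simp add: has_sum_finite)
  then have "(\<lambda>m. \<Sum>k\<le>m. F (k, m - k)) sums infsum F (UNIV \<times> UNIV)"
    by (rule has_sum_imp_sums)
  moreover have "(\<Sum>k\<le>m. F (k, m - k)) =
      (x / 2) powr (2 * real m + \<nu> + 1) * rGamma (real m + 3 / 2) * rGamma (real m + \<nu> + 3 / 2)" for m
  proof -
    have "(\<Sum>k\<le>m. F (k, m - k)) = c * (y\<^sup>2) ^ m * rGamma (real m + (\<nu> + 3 / 2)) *
            (\<Sum>k\<le>m. (-1) ^ k / (fact k * fact (m - k) * (real k + 1 / 2)))"
      unfolding sum_distrib_left by (rule sum.cong) (auto simp: F_def mult_ac)
    also have "\<dots> = (c * sqrt pi) * (y\<^sup>2) ^ m * rGamma (real m + (\<nu> + 3 / 2)) * rGamma (real m + 3 / 2)"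
      by (simp add: alternating_factorial_sum_half)
    \<comment> \<open>The factor sqrt(pi) of the diagonal sum cancels the pi in sqrt(x / (2 pi)),
      leaving sqrt(x / 2) = y^(1/2).\<close>
    also have "c * sqrt pi = y powr (1 / 2) * y powr (\<nu> + 1 / 2)"
      using x by (simp add: c_def y_def real_sqrt_divide real_sqrt_mult powr_half_sqrt)
    also have "\<dots> = y powr (\<nu> + 1)" by (simp add: powr_add [symmetric] add.commute)
    also have "y powr (\<nu> + 1) * (y\<^sup>2) ^ m = y powr (2 * real m + \<nu> + 1)"
    proof -
      have "(y\<^sup>2) ^ m = y powr (real (2 * m))" using y by (simp only: powr_realpow power_mult)
      then show ?thesis by (simp add: powr_add [symmetric] add_ac)
    qed
    finally show ?thesis by (simp add: y_def add.assoc mult_ac)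
  qed
  ultimately have "struve_L \<nu> x = infsum F (UNIV \<times> UNIV)"
    unfolding struve_L_def by (simp add: sums_iff)
  then show "t sums struve_L \<nu> x" using tsums by simp
qed

section \<open>Monotonicity and decay in the order of the Bessel function\<close>

text \<open>Each factor w + k is at least 1/2. The resulting bound 2^n for 1/(w)_n is crude but
  uniform in w, and harmless against the n! in the series.\<close>

lemma pochhammer_ge_power:
  fixes w :: real
  assumes "w \<ge> 1 / 2"
  shows "pochhammer w n \<ge> (1 / 2) ^ n"
proof (induction n)
  case (Suc n)
  have "(1 / 2) ^ n * (1 / 2) \<le> pochhammer w n * (w + real n)"
    using Suc assms by (intro mult_mono pochhammer_nonneg) auto
  then show ?case by (simp add: pochhammer_Suc)
qed simp

text \<open>Logarithmic differentiation of a product of factors 1/(w + k). In this form the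
  derivative is visibly nonpositive for w > 0.\<close>

lemma has_field_derivative_inverse_pochhammer:
  fixes w :: real
  assumes "w > 0"
  shows "((\<lambda>w. inverse (pochhammer w n)) has_field_derivative
           - (inverse (pochhammer w n) * (\<Sum>k<n. inverse (w + real k)))) (at w)"
proof (induction n)
  case (Suc n)
  have "((\<lambda>w. inverse (w + real n)) has_field_derivative - (inverse (w + real n) * inverse (w + real n))) (at w)"
    using assms by (auto intro!: derivative_eq_intros simp: power2_eq_square)
  from DERIV_mult [OF Suc this]
  have "((\<lambda>w. inverse (pochhammer w n) * inverse (w + real n)) has_field_derivative
      - (inverse (pochhammer w n) * inverse (w + real n) * (\<Sum>k<Suc n. inverse (w + real k)))) (at w)"
    by (rule DERIV_cong) (simp add: algebra_simps)
  then show ?case by (simp add: pochhammer_Suc)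
qed simp

text \<open>The difference is the logarithmic derivative of Gamma(v) / Gamma(v + 1/2), so its sign
  says that this quotient decreases.\<close>

lemma Digamma_le_shift_half:
  fixes v :: real
  assumes "v > 0"
  shows "Digamma v - Digamma (v + 1 / 2) \<le> 0"
  using Digamma_real_mono [of v "v + 1 / 2"] assms by simp

text \<open>\<open>H\<close> is the hypergeometric function 0F1(; w; q). For q >= 0 every term is
  nonnegative and nonincreasing in w; the Weierstrass M-test allows termwise differentiation, so the
  sum inherits both properties. The range w > 1/2 is that of w = v + 1/2 with v > 0.\<close>

lemma hypergeometric_0F1_series:
  fixes q :: real
  assumes q: "q \<ge> 0"
  defines "H \<equiv> \<lambda>w. \<Sum>n. q ^ n / fact n * inverse (pochhammer w n)"
  shows "\<And>w. w > 1 / 2 \<Longrightarrow> summable (\<lambda>n. q ^ n / fact n * inverse (pochhammer w n))"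
    and "\<And>w. w > 1 / 2 \<Longrightarrow> H w \<ge> 0"
    and "\<exists>H'. continuous_on {1/2<..} H' \<and>
           (\<forall>w>1/2. (H has_field_derivative H' w) (at w) \<and> H' w \<le> 0)"
proof -
  let ?h = "\<lambda>n w. q ^ n / fact n * inverse (pochhammer w n)"
  let ?h' = "\<lambda>n w. q ^ n / fact n * - (inverse (pochhammer w n) * (\<Sum>k<n. inverse (w + real k)))"
  have expo: "summable (\<lambda>n. r ^ n / fact n)" for r :: real
    using summable_exp_generic [of r] by (simp add: scaleR_conv_of_real field_simps)
  have inv: "0 \<le> inverse (pochhammer w n)" "inverse (pochhammer w n) \<le> 2 ^ n" if "w > 1 / 2" for w :: real and n
  proof -
    have "0 < (1 / 2 :: real) ^ n" by simp
    moreover have "(1 / 2) ^ n \<le> pochhammer w n" using that by (intro pochhammer_ge_power) simp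
    ultimately have "0 < pochhammer w n \<and> inverse (pochhammer w n) \<le> inverse ((1 / 2) ^ n)"
      using le_imp_inverse_le less_le_trans by blast
    then show "0 \<le> inverse (pochhammer w n)" "inverse (pochhammer w n) \<le> 2 ^ n"
      by (auto simp: power_one_over)
  qed
  show summ: "summable (\<lambda>n. ?h n w)" if "w > 1 / 2" for w
  proof (rule summable_comparison_test')
    show "summable (\<lambda>n. (2 * q) ^ n / fact n)" by (rule expo)
    show "norm (?h n w) \<le> (2 * q) ^ n / fact n" for n
      using mult_left_mono [OF inv(2) [OF that, of n], of "q ^ n / fact n"] inv(1) [OF that, of n] q
      by (simp add: abs_mult power_mult_distrib mult_ac)
  qed
  show "H w \<ge> 0" if "w > 1 / 2" for w
    unfolding H_def using that q inv(1) by (intro suminf_nonneg summ mult_nonneg_nonneg) auto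
  have sum_pos: "0 \<le> (\<Sum>k<n. inverse (w + real k))" if "w > 1 / 2" for w n
    using that by (intro sum_nonneg) auto
  \<comment> \<open>One factor 2^n comes from the inverse Pochhammer symbol. The sum of n
    reciprocals is at most 2n, hence at most 2 * 2^n; together they give 2 * 4^n.\<close>
  have bound: "norm (?h' n w) \<le> 2 * ((4 * q) ^ n / fact n)" if w: "w \<in> {1/2<..}" for n w
  proof -
    have w: "w > 1 / 2" using w by simp
    have "(\<Sum>k<n. inverse (w + real k)) \<le> (\<Sum>k<n. 2)"
    proof (rule sum_mono)
      fix k
      have "inverse (w + real k) \<le> inverse (1 / 2)"
        using w by (intro le_imp_inverse_le) auto
      then show "inverse (w + real k) \<le> 2" by simp
    qed
    also have "\<dots> \<le> 2 * 2 ^ n" using of_nat_less_two_power [of n, where ?'a = real] by simp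
    finally have "inverse (pochhammer w n) * (\<Sum>k<n. inverse (w + real k)) \<le> 2 ^ n * (2 * 2 ^ n)"
      using inv [OF w] sum_pos [OF w] by (intro mult_mono) auto
    also have "\<dots> = 2 * 4 ^ n" by (simp add: power_mult_distrib [symmetric])
    finally have "q ^ n / fact n * (inverse (pochhammer w n) * (\<Sum>k<n. inverse (w + real k)))
        \<le> q ^ n / fact n * (2 * 4 ^ n)"
      using q by (intro mult_left_mono) auto
    moreover have "0 \<le> q ^ n / fact n * (inverse (pochhammer w n) * (\<Sum>k<n. inverse (w + real k)))"
      using q inv [OF w] sum_pos [OF w] by (intro mult_nonneg_nonneg) auto
    ultimately show ?thesis
      by (simp add: power_mult_distrib mult_ac)
  qed
  have summ4: "summable (\<lambda>n. 2 * ((4 * q) ^ n / fact n))"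
    by (intro summable_mult expo)
  have der: "(?h n has_field_derivative ?h' n w) (at w)" if "w > 1 / 2" for n w
    using that by (intro DERIV_cmult has_field_derivative_inverse_pochhammer) simp
  define H' where "H' = (\<lambda>w. \<Sum>n. ?h' n w)"
  have ul: "uniform_limit {1/2<..} (\<lambda>n w. \<Sum>i<n. ?h' i w) H' sequentially"
    unfolding H'_def by (rule Weierstrass_m_test [OF bound summ4])
  have "continuous_on {1/2<..} (?h' n)" for n
  proof -
    have "continuous_on {1/2<..} (\<lambda>w::real. inverse (pochhammer w n))"
      by (intro continuous_at_imp_continuous_on ballI
          DERIV_isCont [OF has_field_derivative_inverse_pochhammer]) auto
    then show ?thesis by (auto intro!: continuous_intros)
  qed
  then have "continuous_on {1/2<..} H'"
    by (intro uniform_limit_theorem [OF _ ul] always_eventually allI continuous_on_sum) auto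
  moreover have "(H has_field_derivative H' w) (at w)" if "w > 1/2" for w
    unfolding H_def H'_def
  proof (rule has_field_derivative_series' [where S = "{1/2<..}"])
    show "uniformly_convergent_on {1/2<..} (\<lambda>n w. \<Sum>i<n. ?h' i w)"
      using ul unfolding uniformly_convergent_on_def by blast
    show "summable (\<lambda>n. ?h n 1)" by (rule summ) simp
  qed (use that der in \<open>auto intro: has_field_derivative_at_within simp: interior_open\<close>)
  moreover have "H' w \<le> 0" if w: "w > 1/2" for w
  proof -
    have "summable (\<lambda>n. ?h' n w)"
      by (rule summable_comparison_test' [OF summ4]) (use bound that in auto)
    moreover have "?h' n w \<le> 0" for n
      using q inv [OF w] sum_pos [OF w]
      by (simp add: mult_nonneg_nonneg)
    ultimately have "H' w \<le> (\<Sum>n. 0)"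
      unfolding H'_def by (intro suminf_le) auto
    then show ?thesis by simp
  qed
  ultimately show "\<exists>H'. continuous_on {1/2<..} H' \<and>
           (\<forall>w>1/2. (H has_field_derivative H' w) (at w) \<and> H' w \<le> 0)"
    by blast
qed

text \<open>Since Gamma(v + 1/2 + n) = (v + 1/2)_n Gamma(v + 1/2), the n = 0 term factors out of the
  Bessel series. With v = u + \<nu> + 1 the left side is the function differentiated in the theorem,
  so the dependence on the order splits into three factors that can be studied separately.\<close>

lemma Gamma_bessel_I_eq_hypergeometric:
  fixes v x :: real
  assumes "v > 0" and x: "0 < x"
  shows "Gamma v * bessel_I (v - 1 / 2) x = (x / 2) powr (v - 1 / 2) * (Gamma v * rGamma (v + 1 / 2)) *
     (\<Sum>n. ((x / 2)\<^sup>2) ^ n / fact n * inverse (pochhammer (v + 1 / 2) n))"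
proof -
  have "bessel_I (v - 1 / 2) x = (\<Sum>n. ((x / 2) powr (v - 1 / 2) * rGamma (v + 1 / 2)) *
       (((x / 2)\<^sup>2) ^ n / fact n * inverse (pochhammer (v + 1 / 2) n)))"
    unfolding bessel_I_def
  proof (rule suminf_cong)
    fix n
    have "pochhammer (v + 1 / 2) n > 0" using assms by (intro pochhammer_pos) simp
    then have "rGamma (real n + (v - 1 / 2) + 1) = rGamma (v + 1 / 2) * inverse (pochhammer (v + 1 / 2) n)"
      using pochhammer_rGamma [of "v + 1 / 2" n] by (simp add: field_simps)
    moreover have "(x / 2) powr (2 * real n + (v - 1 / 2)) = (x / 2) powr real (2 * n) * (x / 2) powr (v - 1 / 2)"
      by (simp add: powr_add [symmetric])
    moreover have "(x / 2) powr real (2 * n) = ((x / 2)\<^sup>2) ^ n"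
      using x by (subst powr_realpow) (auto simp: power_mult)
    ultimately show "(x / 2) powr (2 * real n + (v - 1 / 2)) * rGamma (real n + (v - 1 / 2) + 1) / fact n =
       (x / 2) powr (v - 1 / 2) * rGamma (v + 1 / 2) *
       (((x / 2)\<^sup>2) ^ n / fact n * inverse (pochhammer (v + 1 / 2) n))"
      by simp
  qed
  also have "\<dots> = (x / 2) powr (v - 1 / 2) * rGamma (v + 1 / 2) *
       (\<Sum>n. ((x / 2)\<^sup>2) ^ n / fact n * inverse (pochhammer (v + 1 / 2) n))"
    using assms by (intro suminf_mult hypergeometric_0F1_series(1)) auto
  finally show ?thesis by (simp add: mult_ac)
qed

text \<open>All three factors, the power y^(v - 1/2), the Gamma quotient and the 0F1 series, are
  nonnegative and nonincreasing for v > 0. The power decreases to 0 because y = x/2 < 1, while the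
  product \<open>Q\<close> of the other two stays bounded.\<close>

lemma Gamma_bessel_I_decreasing:
  fixes x :: real
  assumes x: "0 < x" "x < 2"
  defines "G \<equiv> \<lambda>v. Gamma v * bessel_I (v - 1 / 2) x"
  shows "\<exists>G'. continuous_on {0<..} G' \<and> (\<forall>v>0. (G has_field_derivative G' v) (at v) \<and> G' v \<le> 0)"
    and "\<And>v. v > 0 \<Longrightarrow> G v \<ge> 0"
    and "(G \<longlongrightarrow> 0) at_top"
proof -
  define y where "y = x / 2"
  have y: "0 < y" "y < 1" using x by (auto simp: y_def)
  then have lny: "ln y < 0" by simp
  define H where "H = (\<lambda>w. \<Sum>n. (y\<^sup>2) ^ n / fact n * inverse (pochhammer w n))"
  obtain H' where H': "continuous_on {1/2<..} H'"
    "\<And>w. w > 1/2 \<Longrightarrow> (H has_field_derivative H' w) (at w)" "\<And>w. w > 1/2 \<Longrightarrow> H' w \<le> 0"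
    using hypergeometric_0F1_series(3) [of "y\<^sup>2"] unfolding H_def by auto
  have H0: "H w \<ge> 0" if "w > 1 / 2" for w
    unfolding H_def using that by (intro hypergeometric_0F1_series(2)) auto
  define Q where "Q = (\<lambda>v. Gamma v * rGamma (v + 1 / 2) * H (v + 1 / 2))"
  define Q' where "Q' = (\<lambda>v. Gamma v * rGamma (v + 1 / 2) *
     ((Digamma v - Digamma (v + 1 / 2)) * H (v + 1 / 2) + H' (v + 1 / 2)))"
  have npi: "v \<notin> \<int>\<^sub>\<le>\<^sub>0" if "v > 0" for v :: real
    using that nonpos_Ints_nonpos by force
  have rG: "rGamma v > 0" if "v > 0" for v :: real
    using that by (simp add: rGamma_inverse_Gamma)
  have HD: "((\<lambda>v. H (v + 1 / 2)) has_field_derivative H' (v + 1 / 2)) (at v)" if "v > 0" for v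
    using H'(2) [of "v + 1 / 2"] that by (simp add: DERIV_shift)
  have QD: "(Q has_field_derivative Q' v) (at v)" if "v > 0" for v
    unfolding Q_def Q'_def using that npi [of "v + 1 / 2"]
    by (auto intro!: derivative_eq_intros HD npi simp: algebra_simps)
  have Q0: "Q v \<ge> 0" if "v > 0" for v
    unfolding Q_def using that rG [of "v + 1 / 2"] by (intro mult_nonneg_nonneg H0) auto
  have Q'0: "Q' v \<le> 0" if "v > 0" for v
    unfolding Q'_def
    using that rG [of "v + 1 / 2"] Digamma_le_shift_half [of v] H0 [of "v + 1 / 2"] H'(3) [of "v + 1 / 2"]
    by (intro mult_nonneg_nonpos add_nonpos_nonpos mult_nonpos_nonneg mult_nonneg_nonneg) auto
  have G_eq: "G v = y powr (v - 1 / 2) * Q v" if "v > 0" for v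
    unfolding G_def Q_def H_def y_def
    using Gamma_bessel_I_eq_hypergeometric [OF that x(1)] by (simp add: mult_ac)
  define G' where "G' = (\<lambda>v. y powr (v - 1 / 2) * (ln y * Q v + Q' v))"
  have GD: "(G has_field_derivative G' v) (at v)" if "v > 0" for v
  proof -
    have "((\<lambda>v. y powr (v - 1 / 2) * Q v) has_field_derivative G' v) (at v)"
      unfolding G'_def using y that by (auto intro!: derivative_eq_intros QD simp: algebra_simps)
    \<comment> \<open>The factorisation is known for positive arguments only; these form a
      neighbourhood of v, which is enough to transfer the derivative.\<close>
    moreover have "eventually (\<lambda>v. G v = y powr (v - 1 / 2) * Q v) (nhds v)"
      by (rule eventually_mono [OF eventually_nhds_in_open [of "{0<..}" v]]) (use that G_eq in auto)
    ultimately show ?thesis by (subst DERIV_cong_ev) auto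
  qed
  have "continuous_on {0<..} G'"
  proof -
    have "continuous_on {0<..} Q" using QD by (intro DERIV_continuous_on) (auto intro: has_field_derivative_at_within)
    moreover have "continuous_on {0<..} (\<lambda>v. H (v + 1 / 2))"
      using HD by (intro DERIV_continuous_on) (auto intro: has_field_derivative_at_within)
    moreover have "continuous_on {0<..} (\<lambda>v. H' (v + 1 / 2))"
      by (rule continuous_on_compose2 [OF H'(1)]) (auto intro!: continuous_intros)
    moreover have "continuous_on {0<..} (Gamma :: real \<Rightarrow> real)"
      by (intro continuous_on_Gamma) (use npi in auto)
    moreover have "continuous_on {0<..} (\<lambda>v::real. rGamma (v + 1 / 2))"
      by (rule continuous_on_compose2 [OF continuous_on_rGamma [of UNIV]]) (auto intro!: continuous_intros)
    moreover have D: "continuous_on {0<..} (Digamma :: real \<Rightarrow> real)"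
      by (intro continuous_on_Polygamma) (use npi in auto)
    moreover have "continuous_on {0<..} (\<lambda>v::real. Digamma (v + 1 / 2))"
      by (rule continuous_on_compose2 [OF D]) (auto intro!: continuous_intros)
    ultimately show ?thesis
      unfolding G'_def Q'_def using y by (intro continuous_intros) auto
  qed
  moreover have "G' v \<le> 0" if "v > 0" for v
    unfolding G'_def using that lny Q0 [of v] Q'0 [of v]
    by (intro mult_nonneg_nonpos add_nonpos_nonpos mult_nonpos_nonneg) auto
  ultimately show "\<exists>G'. continuous_on {0<..} G' \<and> (\<forall>v>0. (G has_field_derivative G' v) (at v) \<and> G' v \<le> 0)"
    using GD by blast
  show "G v \<ge> 0" if "v > 0" for v
    using that G_eq Q0 by auto
  \<comment> \<open>Monotonicity bounds \<open>Q\<close> by its value at 1, so the decay of the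
    power alone forces the limit 0.\<close>
  have Q1: "Q v \<le> Q 1" if "v \<ge> 1" for v
  proof (rule DERIV_nonpos_imp_nonincreasing [OF that])
    show "\<exists>d. (Q has_field_derivative d) (at u) \<and> d \<le> 0" if "1 \<le> u" for u
      using that QD [of u] Q'0 [of u] by auto
  qed
  have "((\<lambda>v. y powr (v - 1 / 2) * Q 1) \<longlongrightarrow> 0) at_top"
  proof -
    have "filterlim (\<lambda>v::real. - (1 / 2) + v) at_top at_top"
      by (rule filterlim_tendsto_add_at_top [OF tendsto_const filterlim_ident])
    then have "filterlim (\<lambda>v. ln y * (v - 1 / 2)) at_bot at_top"
      using lny by (intro filterlim_tendsto_neg_mult_at_bot [OF tendsto_const]) simp_all
    then have "((\<lambda>v. exp (ln y * (v - 1 / 2))) \<longlongrightarrow> 0) at_top"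
      by (rule filterlim_compose [OF exp_at_bot])
    then have "((\<lambda>v. y powr (v - 1 / 2)) \<longlongrightarrow> 0) at_top"
      using y by (simp add: powr_def mult.commute)
    then show ?thesis by (rule tendsto_mult_left_zero)
  qed
  moreover have "eventually (\<lambda>v. norm (G v) \<le> y powr (v - 1 / 2) * Q 1) at_top"
    using eventually_ge_at_top [of 1]
    by eventually_elim (use Q0 Q1 in \<open>auto simp: G_eq abs_mult intro!: mult_left_mono\<close>)
  ultimately show "(G \<longlongrightarrow> 0) at_top"
    by (rule Lim_null_comparison [rotated])
qed

section \<open>Abel summation against a decreasing function\<close>

text \<open>The sum up to [u] is a series of c k times the indicator of u >= k, and the integral of
  g' from k to infinity is -g(k). As g' has constant sign, the L1 norm of the k-th summand is
  exactly norm (c k) * g(k), so \<open>summ\<close> is the condition for integrating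
  termwise.\<close>

lemma abel_summation_integral:
  fixes g g' :: "real \<Rightarrow> real" and c :: "nat \<Rightarrow> 'a::{banach, second_countable_topology}"
  assumes g: "\<And>u. u \<ge> 1 \<Longrightarrow> (g has_field_derivative g' u) (at u)"
    and g': "continuous_on {1..} g'" "\<And>u. u \<ge> 1 \<Longrightarrow> g' u \<le> 0"
    and lim: "(g \<longlongrightarrow> 0) at_top"
    and summ: "summable (\<lambda>k. norm (c k) * g (real k))"
  shows "set_integrable lborel {1<..} (\<lambda>u. g' u *\<^sub>R (\<Sum>k=1..nat \<lfloor>u\<rfloor>. c k))"
    and "(\<lambda>k. - g (real (Suc k)) *\<^sub>R c (Suc k)) sums
           (LBINT u:{1<..}. g' u *\<^sub>R (\<Sum>k=1..nat \<lfloor>u\<rfloor>. c k))"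
proof -
  have FTC: "set_integrable lborel {b<..} (\<lambda>u. - g' u)" "(LBINT u:{b<..}. - g' u) = g b"
    if b: "b \<ge> 1" for b :: real
  proof -
    have neg_g: "((\<lambda>u. - g u) has_field_derivative - g' u) (at u)" if "u > b" for u
      using that b by (intro DERIV_minus g) simp
    have cont: "isCont (\<lambda>u. - g' u) u" if "u > b" for u
    proof -
      have "isCont g' u"
        using that b by (intro continuous_on_interior [OF g'(1)]) auto
      then show ?thesis by (intro continuous_intros)
    qed
    have "continuous (at b) (\<lambda>u. - g u)"
      using b DERIV_isCont [OF g] by (intro continuous_intros) auto
    then have lim_b: "((\<lambda>u. - g u) \<longlongrightarrow> - g b) (at_right b)"
      unfolding isCont_def by (rule tendsto_within_subset) auto
    have lim_top: "((\<lambda>u. - g u) \<longlongrightarrow> 0) at_top"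
      using tendsto_minus [OF lim] by simp
    \<comment> \<open>Passing to -g' makes the integrand nonnegative, so the fundamental theorem on
      an infinite interval yields integrability along with the value.\<close>
    note FTC = interval_integral_FTC_nonneg [of "ereal b" \<infinity> "\<lambda>u. - g u" "\<lambda>u. - g' u" "- g b" 0]
    have nonneg: "AE u in lborel. ereal b < ereal u \<longrightarrow> ereal u < \<infinity> \<longrightarrow> 0 \<le> - g' u"
      using b g'(2) by auto
    show "set_integrable lborel {b<..} (\<lambda>u. - g' u)"
      using FTC(1) neg_g cont nonneg lim_b lim_top
      by (simp add: ereal_tendsto_simps1)
    show "(LBINT u:{b<..}. - g' u) = g b"
      using FTC(2) neg_g cont nonneg lim_b lim_top
      by (simp add: ereal_tendsto_simps1 interval_integral_to_infinity_eq)
  qed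
  \<comment> \<open>Intersecting with \<open>{1<..}\<close> matters only for k = 0, where it removes
    the endpoint 1. Each \<open>I k\<close> differs from the open half-line beyond
    \<open>Suc k\<close> by at most one point, a null set.\<close>
  define I where "I = (\<lambda>k. {1<..} \<inter> {real (Suc k)..})"
  have I: "set_integrable lborel (I k) g'" "(LBINT u:I k. g' u) = - g (real (Suc k))" for k
  proof -
    have "set_integrable lborel {1<..} g'"
      using integrable_minus [OF FTC(1) [of 1, unfolded set_integrable_def]]
      by (simp add: set_integrable_def)
    then show "set_integrable lborel (I k) g'"
      by (rule set_integrable_subset) (auto simp: I_def)
    have "(LBINT u:I k. g' u) = (LBINT u:{real (Suc k)<..}. g' u)"
      by (rule set_integral_discrete_difference [where X = "{real (Suc k)}"]) (auto simp: I_def)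
    also have "\<dots> = - (LBINT u:{real (Suc k)<..}. - g' u)"
      by (simp add: set_lebesgue_integral_def)
    also have "\<dots> = - g (real (Suc k))" by (subst FTC(2)) auto
    finally show "(LBINT u:I k. g' u) = - g (real (Suc k))" .
  qed
  define f where "f = (\<lambda>k u. (indicator (I k) u *\<^sub>R g' u) *\<^sub>R c (Suc k))"
  have f_int: "integrable lborel (f k)" for k
    unfolding f_def using I(1) [of k] unfolding set_integrable_def
    by (intro integrable_scaleR_left) auto
  have f_val: "(LBINT u. f k u) = - g (real (Suc k)) *\<^sub>R c (Suc k)" for k
    using I [of k] unfolding f_def set_integrable_def set_lebesgue_integral_def
    by (subst integral_scaleR_left) auto
  have f_norm: "(LBINT u. norm (f k u)) = norm (c (Suc k)) * g (real (Suc k))" for k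
  proof -
    have "norm (f k u) = (indicator (I k) u *\<^sub>R g' u) * - norm (c (Suc k))" for u
      using g'(2) [of u] by (auto simp: f_def I_def indicator_def)
    then have "(LBINT u. norm (f k u)) = (LBINT u. (indicator (I k) u *\<^sub>R g' u) * - norm (c (Suc k)))"
      by simp
    also have "\<dots> = (LBINT u:I k. g' u) * - norm (c (Suc k))"
      unfolding set_lebesgue_integral_def by (rule integral_mult_left_zero)
    finally show ?thesis by (simp add: I(2))
  qed
  \<comment> \<open>For fixed u only indices with k + 1 at most [u] contribute, so pointwise the
    series is a finite sum. For u <= 1 both sides vanish through the indicator.\<close>
  have f_sum: "(\<lambda>k. f k u) sums (indicator {1<..} u *\<^sub>R (g' u *\<^sub>R (\<Sum>k=1..nat \<lfloor>u\<rfloor>. c k)))" for u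
  proof -
    have "(\<lambda>k. f k u) sums (\<Sum>k<nat \<lfloor>u\<rfloor>. f k u)"
    proof (rule sums_finite)
      fix k assume "k \<notin> {..<nat \<lfloor>u\<rfloor>}"
      then have "u < real (Suc k)" by (simp add: not_less) linarith
      then show "f k u = 0" by (simp add: f_def I_def)
    qed simp
    also have "(\<Sum>k<nat \<lfloor>u\<rfloor>. f k u) = (\<Sum>k<nat \<lfloor>u\<rfloor>. indicator {1<..} u *\<^sub>R (g' u *\<^sub>R c (Suc k)))"
    proof (rule sum.cong)
      fix k assume "k \<in> {..<nat \<lfloor>u\<rfloor>}"
      then have "real (Suc k) \<le> u" by simp linarith
      then show "f k u = indicator {1<..} u *\<^sub>R (g' u *\<^sub>R c (Suc k))"
        by (simp add: f_def I_def indicator_def)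
    qed simp
    also have "\<dots> = indicator {1<..} u *\<^sub>R (g' u *\<^sub>R (\<Sum>k<nat \<lfloor>u\<rfloor>. c (Suc k)))"
      by (simp add: scaleR_sum_right)
    also have "(\<Sum>k<nat \<lfloor>u\<rfloor>. c (Suc k)) = (\<Sum>k=1..nat \<lfloor>u\<rfloor>. c k)"
      by (simp add: sum.atLeast1_atMost_eq)
    finally show ?thesis .
  qed
  have f_summable: "AE u in lborel. summable (\<lambda>k. norm (f k u))"
  proof (rule AE_I2)
    fix u
    show "summable (\<lambda>k. norm (f k u))"
    proof (rule summable_finite [where N = "{..<nat \<lfloor>u\<rfloor>}"])
      fix k assume "k \<notin> {..<nat \<lfloor>u\<rfloor>}"
      then have "u < real (Suc k)" by (simp add: not_less) linarith
      then show "norm (f k u) = 0" by (simp add: f_def I_def)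
    qed simp
  qed
  have "summable (\<lambda>k. LBINT u. norm (f k u))"
    unfolding f_norm using summ by (subst summable_Suc_iff)
  note fubini = integrable_suminf [OF f_int f_summable this] sums_integral [OF f_int f_summable this]
  have f_suminf: "(\<lambda>u. \<Sum>k. f k u) = (\<lambda>u. indicator {1<..} u *\<^sub>R (g' u *\<^sub>R (\<Sum>k=1..nat \<lfloor>u\<rfloor>. c k)))"
    using f_sum by (simp add: sums_iff)
  show "set_integrable lborel {1<..} (\<lambda>u. g' u *\<^sub>R (\<Sum>k=1..nat \<lfloor>u\<rfloor>. c k))"
    unfolding set_integrable_def using fubini(1) unfolding f_suminf .
  show "(\<lambda>k. - g (real (Suc k)) *\<^sub>R c (Suc k)) sums
           (LBINT u:{1<..}. g' u *\<^sub>R (\<Sum>k=1..nat \<lfloor>u\<rfloor>. c k))"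
    unfolding set_lebesgue_integral_def using fubini(2) unfolding f_suminf f_val .
qed

section \<open>The inner integral as a partial sum\<close>

text \<open>On [k, k+1) the fractional part is s - k, and f + (s - k) f' is the derivative of (s -
  k) f(s). The lower endpoint contributes 0 and the upper one f(k+1), which is why the sum starts at
  1. Derivatives are two-sided even at s = 0, matching the \<open>at s\<close> in
  \<open>frac_diff_op\<close>.\<close>

lemma frac_diff_op_integral:
  fixes f f' :: "real \<Rightarrow> 'a::euclidean_space"
  assumes D: "\<And>s. s \<ge> 0 \<Longrightarrow> (f has_vector_derivative f' s) (at s)"
    and C: "continuous_on {0..} f'"
  shows "set_integrable lborel {0..<real n} (frac_diff_op f) \<and>
     (LBINT s:{0..<real n}. frac_diff_op f s) = (\<Sum>k=1..n. f (real k))"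
proof (induction n)
  case 0
  then show ?case by (simp add: set_integrable_def set_lebesgue_integral_def)
next
  case (Suc n)
  let ?N = "real n"
  let ?h = "\<lambda>s. f s + (s - ?N) *\<^sub>R f' s"
  have eq: "frac_diff_op f s = ?h s" if "s \<in> {?N..<?N + 1}" for s
  proof -
    have "s \<ge> 0"
      using that of_nat_0_le_iff [of n, where ?'a = real] by (meson atLeastLessThan_iff order_trans)
    have "\<lfloor>s\<rfloor> = int n" using that by (intro floor_unique) auto
    then have "frac s = s - ?N" by (simp add: frac_def)
    moreover have "vector_derivative f (at s) = f' s"
      using \<open>s \<ge> 0\<close> by (intro vector_derivative_at D)
    ultimately show ?thesis by (simp add: frac_diff_op_def)
  qed
  have cont: "continuous_on {?N..?N + 1} ?h"
  proof (intro continuous_intros)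
    show "continuous_on {?N..?N + 1} f'"
      by (rule continuous_on_subset [OF C]) auto
    have "continuous_on {0..} f"
      by (intro continuous_at_imp_continuous_on ballI has_vector_derivative_continuous [OF D]) simp
    then show "continuous_on {?N..?N + 1} f"
      by (rule continuous_on_subset) auto
  qed
  have int: "set_integrable lborel {?N..<?N + 1} (frac_diff_op f)"
  proof -
    have "set_integrable lborel {?N..<?N + 1} ?h"
      by (rule set_integrable_subset [OF borel_integrable_atLeastAtMost' [OF cont]]) auto
    moreover have "set_integrable lborel {?N..<?N + 1} (frac_diff_op f) = set_integrable lborel {?N..<?N + 1} ?h"
      by (rule set_integrable_cong [OF refl refl eq])
    ultimately show ?thesis by (simp only:)
  qed
  have "(LBINT s:{?N..<?N + 1}. frac_diff_op f s) = (LBINT s:{?N..<?N + 1}. ?h s)"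
    by (rule set_lebesgue_integral_cong, simp, intro allI impI eq)
  also have "\<dots> = (LBINT s=?N..?N + 1. ?h s)"
    by (subst interval_integral_Ico) auto
  also have "\<dots> = (?N + 1 - ?N) *\<^sub>R f (?N + 1) - (?N - ?N) *\<^sub>R f ?N"
  proof (rule interval_integral_FTC_finite)
    show "continuous_on {min ?N (?N + 1)..max ?N (?N + 1)} ?h" using cont by simp
    fix s assume "min ?N (?N + 1) \<le> s"
    then have "s \<ge> 0" by simp
    have "((\<lambda>s. s - ?N) has_field_derivative 1) (at s)"
      by (rule DERIV_cong [OF DERIV_diff [OF DERIV_ident DERIV_const]]) simp
    then have "((\<lambda>s. (s - ?N) *\<^sub>R f s) has_vector_derivative (s - ?N) *\<^sub>R f' s + 1 *\<^sub>R f s) (at s)"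
      by (rule has_vector_derivative_scaleR [OF _ D [OF \<open>s \<ge> 0\<close>]])
    moreover have "(s - ?N) *\<^sub>R f' s + 1 *\<^sub>R f s = ?h s" by simp
    ultimately show "((\<lambda>s. (s - ?N) *\<^sub>R f s) has_vector_derivative ?h s) (at s within {min ?N (?N + 1)..max ?N (?N + 1)})"
      by (simp only: has_vector_derivative_at_within)
  qed
  finally have val: "(LBINT s:{?N..<?N + 1}. frac_diff_op f s) = f (?N + 1)" by simp
  have split: "{0..<real (Suc n)} = {0..<?N} \<union> {?N..<?N + 1}" by auto
  show ?case unfolding split
  proof
    show "set_integrable lborel ({0..<?N} \<union> {?N..<?N + 1}) (frac_diff_op f)"
      using Suc int by (intro set_integrable_Un) auto
    have "(LBINT s:{0..<?N} \<union> {?N..<?N + 1}. frac_diff_op f s) = (\<Sum>k=1..n. f (real k)) + f (?N + 1)"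
      using Suc int val by (subst set_integral_Un) auto
    then show "(LBINT s:{0..<?N} \<union> {?N..<?N + 1}. frac_diff_op f s) = (\<Sum>k=1..Suc n. f (real k))"
      by (simp add: add.commute)
  qed
qed

text \<open>\<open>a\<close> is the restriction to the real axis of a function \<open>b\<close>
  holomorphic for Re z > -1/2: \<open>rGamma\<close> is entire, and the only possible singularity is
  z = -1/2. Holomorphy gives the derivative and its continuity together, and the open half-plane
  contains 0.\<close>

lemma struve_beta_rGamma_differentiable:
  fixes x \<nu> :: real
  assumes x: "0 < x"
  defines "a \<equiv> \<lambda>s::real. struve_beta x s * of_real (rGamma (s + \<nu> + 1))"
  shows "\<exists>a'. continuous_on {0..} a' \<and> (\<forall>s\<ge>0. (a has_vector_derivative a' s) (at s))"
proof -
  define b :: "complex \<Rightarrow> complex" where "b = (\<lambda>z. - (of_real (sqrt (x / (2 * pi))) *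
        (exp (\<i> * of_real pi * z) * exp (z * of_real (ln (x / 2))) * rGamma (z + 1) / (z + 1 / 2))) *
        rGamma (z + of_real \<nu> + 1))"
  have open_halfplane: "open {z. Re z > - (1 / 2)}" by (rule open_halfspace_Re_gt)
  have nz: "z + 1 / 2 \<noteq> 0" if "Re z > - (1 / 2)" for z
  proof
    assume "z + 1 / 2 = 0"
    then have "Re (z + 1 / 2) = 0" by simp
    then show False using that by simp
  qed
  have hol: "b holomorphic_on {z. Re z > - (1 / 2)}"
    unfolding b_def using nz by (intro holomorphic_intros) auto
  have b: "b (of_real s) = a s" for s
  proof -
    have 1: "rGamma (complex_of_real s + 1) = of_real (rGamma (s + 1))"
      by (metis of_real_1 of_real_add rGamma_complex_of_real)
    have 2: "rGamma (complex_of_real s + of_real \<nu> + 1) = of_real (rGamma (s + \<nu> + 1))"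
      by (metis of_real_1 of_real_add rGamma_complex_of_real)
    have 3: "exp (complex_of_real s * of_real (ln (x / 2))) = of_real ((x / 2) powr s)"
      using x by (simp add: powr_def exp_of_real [symmetric])
    have 4: "complex_of_real s + 1 / 2 = of_real (s + 1 / 2)"
      by simp
    show ?thesis unfolding b_def a_def struve_beta_def 1 2 3 4 ..
  qed
  have "continuous_on {0..} (\<lambda>s::real. deriv b (of_real s))"
    by (rule continuous_on_compose2 [OF holomorphic_on_imp_continuous_on
          [OF holomorphic_deriv [OF hol open_halfplane]]]) (auto intro!: continuous_intros)
  moreover have "(a has_vector_derivative deriv b (of_real s)) (at s)" if "s \<ge> 0" for s
  proof -
    have "(b has_field_derivative deriv b (of_real s)) (at (of_real s))"
      using that by (intro holomorphic_derivI [OF hol open_halfplane]) auto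
    then have "((\<lambda>s. b (of_real s)) has_vector_derivative deriv b (of_real s)) (at s)"
      by (intro has_vector_derivative_real_field) (auto intro: has_field_derivative_at_within)
    then show ?thesis by (simp add: b)
  qed
  ultimately show ?thesis by blast
qed

section \<open>Combining the series expansion, the partial sums and Abel summation\<close>

theorem theorem3:
  fixes \<nu> x :: real
  assumes "\<nu> + 2 > 0" and "0 < x" and "x < 2"
  defines "a \<equiv> \<lambda>s::real. struve_beta x s * of_real (rGamma (s + \<nu> + 1))"
  defines "A \<equiv> \<lambda>u::real. LBINT s=0..real_of_int \<lfloor>u\<rfloor>. frac_diff_op a s"
  defines "g' \<equiv> \<lambda>u::real. deriv (\<lambda>t. Gamma (t + \<nu> + 1) * bessel_I (t + \<nu> + 1 / 2) x) u"
  shows "(\<forall>u::real. u \<ge> 1 \<longrightarrow>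
            interval_lebesgue_integrable lborel 0 (ereal (real_of_int \<lfloor>u\<rfloor>)) (frac_diff_op a)) \<and>
         interval_lebesgue_integrable lborel 1 \<infinity> (\<lambda>u. of_real (g' u) * A u) \<and>
         complex_of_real (struve_L \<nu> x - sqrt (2 * x / pi) * bessel_I (\<nu> + 1 / 2) x) =
           (LBINT u=1..\<infinity>. of_real (g' u) * A u)"
proof -
  define c :: "nat \<Rightarrow> complex" where "c = (\<lambda>k. a (real k))"
  define g where "g = (\<lambda>u. Gamma (u + \<nu> + 1) * bessel_I (u + \<nu> + 1 / 2) x)"
  define t where "t = (\<lambda>k. sqrt (x / (2 * pi)) * (-1) ^ k * (x / 2) ^ k / (fact k * (real k + 1 / 2)) *
                     bessel_I (real k + \<nu> + 1 / 2) x)"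
  define P where "P = (\<lambda>u::real. \<Sum>k=1..nat \<lfloor>u\<rfloor>. c k)"
  have t: "t sums struve_L \<nu> x" "summable (\<lambda>k. \<bar>t k\<bar>)"
    unfolding t_def by (rule struve_L_bessel_I_series [OF assms(2)])+
  obtain a' where a': "continuous_on {0..} a'" "\<And>s. s \<ge> 0 \<Longrightarrow> (a has_vector_derivative a' s) (at s)"
    using struve_beta_rGamma_differentiable [OF assms(2), of \<nu>] unfolding a_def by blast
  note frac_int = frac_diff_op_integral [OF a'(2,1)]

  have floor_eq: "real_of_int \<lfloor>u\<rfloor> = real (nat \<lfloor>u\<rfloor>)" if "u \<ge> 1" for u :: real
    using that by simp
  have inner: "interval_lebesgue_integrable lborel 0 (ereal (real_of_int \<lfloor>u\<rfloor>)) (frac_diff_op a)"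
    and A_eq: "A u = P u" if "u \<ge> 1" for u :: real
  proof -
    have "set_integrable lborel {0<..<real (nat \<lfloor>u\<rfloor>)} (frac_diff_op a)"
      by (rule set_integrable_subset [OF conjunct1 [OF frac_int]]) auto
    then show "interval_lebesgue_integrable lborel 0 (ereal (real_of_int \<lfloor>u\<rfloor>)) (frac_diff_op a)"
      unfolding floor_eq [OF that] zero_ereal_def by (simp add: interval_lebesgue_integrable_def)
    have "A u = (LBINT s=ereal 0..ereal (real (nat \<lfloor>u\<rfloor>)). frac_diff_op a s)"
      unfolding A_def floor_eq [OF that] zero_ereal_def ..
    also have "\<dots> = (LBINT s:{0..<real (nat \<lfloor>u\<rfloor>)}. frac_diff_op a s)"
      by (subst interval_integral_Ico) auto
    also have "\<dots> = P u"
      using frac_int unfolding P_def c_def by blast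
    finally show "A u = P u" .
  qed

  define G where "G = (\<lambda>v. Gamma v * bessel_I (v - 1 / 2) x)"
  obtain G' where G': "continuous_on {0<..} G'" "\<And>v. v > 0 \<Longrightarrow> (G has_field_derivative G' v) (at v)"
      "\<And>v. v > 0 \<Longrightarrow> G' v \<le> 0"
    using Gamma_bessel_I_decreasing(1) [OF assms(2,3)] unfolding G_def by blast
  have G_lim: "(G \<longlongrightarrow> 0) at_top"
    unfolding G_def by (rule Gamma_bessel_I_decreasing(3) [OF assms(2,3)])
  have g_G: "g = (\<lambda>u. G (u + (\<nu> + 1)))"
    by (simp add: g_def G_def add_ac)
  \<comment> \<open>For u >= 1 the argument u + \<nu> + 1 is at least \<nu> + 2, so the hypothesis
    on \<nu> is exactly what keeps it in the range v > 0.\<close>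
  have g_der: "(g has_field_derivative G' (u + (\<nu> + 1))) (at u)" if "u \<ge> 1" for u :: real
    unfolding g_G using G'(2) [of "u + (\<nu> + 1)"] that assms(1) by (simp add: DERIV_shift)
  have g'_eq: "g' u = G' (u + (\<nu> + 1))" if "u \<ge> 1" for u :: real
    unfolding g'_def using DERIV_imp_deriv [OF g_der [OF that]] by (simp add: g_def)
  have g_nonneg: "g u \<ge> 0" if "u \<ge> 1" for u :: real
    using Gamma_bessel_I_decreasing(2) [OF assms(2,3), of "u + (\<nu> + 1)"] that assms(1)
    by (simp add: g_G G_def)
  \<comment> \<open>For k >= 1 the number k + \<nu> + 1 is positive, so the Gamma factor of g
    cancels the \<open>rGamma\<close> in \<open>c k\<close>. The leading minus sign of
    \<open>struve_beta\<close> cancels the one from Abel summation, and exp(i pi k) supplies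
    (-1)^k.\<close>
  have c_g: "- g (real k) *\<^sub>R c k = of_real (t k)" if "k \<ge> 1" for k
  proof -
    have pos: "real k + \<nu> + 1 > 0" using that assms(1) by simp
    then have "Gamma (real k + \<nu> + 1) * rGamma (real k + \<nu> + 1) = 1"
      using Gamma_real_pos [OF pos] unfolding rGamma_inverse_Gamma by (metis right_inverse less_irrefl)
    then have 1: "complex_of_real (Gamma (real k + \<nu> + 1)) * of_real (rGamma (real k + \<nu> + 1)) = 1"
      by (metis of_real_1 of_real_mult)
    have 2: "exp (\<i> * of_real pi * of_real (real k)) = (-1) ^ k"
      using exp_of_nat_mult [of k "\<i> * of_real pi"] by (simp add: mult_ac)
    have 3: "(x / 2) powr real k = (x / 2) ^ k"
      using assms(2) by (simp add: powr_realpow)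
    have 4: "rGamma (real k + 1) = inverse (fact k)"
      using Gamma_fact [of k, where ?'a = real] by (simp add: rGamma_inverse_Gamma add.commute)
    have rearrange: "- (p * q) *\<^sub>R (- (of_real r * (e * of_real y * of_real (inverse f) / of_real d)) * of_real w) =
        of_real r * e * of_real y / of_real (f * d) * of_real q * (of_real p * of_real w)"
      for p q r y f d w :: real and e :: complex
      by (simp add: scaleR_conv_of_real divide_inverse mult_ac)
    have "- g (real k) *\<^sub>R c k =
        of_real (sqrt (x / (2 * pi))) * (-1) ^ k * of_real ((x / 2) ^ k) /
          of_real (fact k * (real k + 1 / 2)) * of_real (bessel_I (real k + \<nu> + 1 / 2) x) *
        (of_real (Gamma (real k + \<nu> + 1)) * of_real (rGamma (real k + \<nu> + 1)))"
      unfolding c_def a_def g_def struve_beta_def 2 3 4 by (rule rearrange)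
    then show ?thesis unfolding 1 t_def by simp
  qed
  \<comment> \<open>By \<open>c_g\<close> and g >= 0 the terms equal the absolute values of
    \<open>t k\<close> from k = 1 on, so the absolute convergence of the Bessel expansion carries
    over.\<close>
  have summ: "summable (\<lambda>k. norm (c k) * g (real k))"
  proof (rule summable_comparison_test_ev [OF _ t(2)])
    show "\<forall>\<^sub>F k in sequentially. norm (norm (c k) * g (real k)) \<le> \<bar>t k\<bar>"
      using eventually_ge_at_top [of 1]
    proof eventually_elim
      case (elim k)
      have "\<bar>t k\<bar> = norm (- g (real k) *\<^sub>R c k)"
        using c_g [OF elim] by simp
      also have "\<dots> = norm (c k) * g (real k)"
        using g_nonneg [of "real k"] elim by simp
      finally show ?case using g_nonneg [of "real k"] elim by simp
    qed
  qed
  have abel_prems: "\<And>u. u \<ge> 1 \<Longrightarrow> (g has_field_derivative g' u) (at u)"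
      "continuous_on {1..} g'" "\<And>u. u \<ge> 1 \<Longrightarrow> g' u \<le> 0" "(g \<longlongrightarrow> 0) at_top"
  proof -
    show "(g has_field_derivative g' u) (at u)" "g' u \<le> 0" if "u \<ge> 1" for u :: real
      using g_der [OF that] g'_eq [OF that] G'(3) [of "u + (\<nu> + 1)"] that assms(1) by auto
    have "continuous_on {1..} (\<lambda>u. G' (u + (\<nu> + 1)))"
      by (rule continuous_on_compose2 [OF G'(1)]) (use assms(1) in \<open>auto intro!: continuous_intros\<close>)
    then show "continuous_on {1..} g'"
      using continuous_on_cong [of "{1..}" "{1..}" g' "\<lambda>u. G' (u + (\<nu> + 1))"] g'_eq by simp
    show "(g \<longlongrightarrow> 0) at_top"
      unfolding g_G
    proof (rule filterlim_compose [OF G_lim])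
      have "filterlim (\<lambda>u. (\<nu> + 1) + u) at_top at_top"
        by (rule filterlim_tendsto_add_at_top [OF tendsto_const filterlim_ident])
      then show "filterlim (\<lambda>u. u + (\<nu> + 1)) at_top at_top"
        by (subst add.commute)
    qed
  qed
  have abel: "set_integrable lborel {1<..} (\<lambda>u. g' u *\<^sub>R (\<Sum>k=1..nat \<lfloor>u\<rfloor>. c k))"
      "(\<lambda>k. - g (real (Suc k)) *\<^sub>R c (Suc k)) sums
         (LBINT u:{1<..}. g' u *\<^sub>R (\<Sum>k=1..nat \<lfloor>u\<rfloor>. c k))"
    by (rule abel_summation_integral [where g = g]; fact)+
  have integrand: "g' u *\<^sub>R (\<Sum>k=1..nat \<lfloor>u\<rfloor>. c k) = of_real (g' u) * A u" if "u \<in> {1<..}" for u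
  proof -
    have "A u = P u" using that by (intro A_eq) simp
    then show ?thesis by (simp only: P_def scaleR_conv_of_real)
  qed
  have "set_integrable lborel {1<..} (\<lambda>u. g' u *\<^sub>R (\<Sum>k=1..nat \<lfloor>u\<rfloor>. c k)) =
      set_integrable lborel {1<..} (\<lambda>u. of_real (g' u) * A u)"
    by (rule set_integrable_cong [OF refl refl integrand])
  then have outer: "set_integrable lborel {1<..} (\<lambda>u. of_real (g' u) * A u)"
    using abel(1) by (simp only:)
  have "(\<lambda>k. - g (real (Suc k)) *\<^sub>R c (Suc k)) sums (LBINT u:{1<..}. of_real (g' u) * A u)"
  proof -
    have "(LBINT u:{1<..}. g' u *\<^sub>R (\<Sum>k=1..nat \<lfloor>u\<rfloor>. c k)) = (LBINT u:{1<..}. of_real (g' u) * A u)"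
      by (rule set_lebesgue_integral_cong, simp, intro allI impI integrand)
    then show ?thesis using abel(2) by (simp only:)
  qed
  moreover have "- g (real (Suc k)) *\<^sub>R c (Suc k) = of_real (t (Suc k))" for k
    by (rule c_g) simp
  ultimately have tail_sums: "(\<lambda>k. complex_of_real (t (Suc k))) sums (LBINT u:{1<..}. of_real (g' u) * A u)"
    by (simp only:)
  have "(\<lambda>k. t (Suc k)) sums (struve_L \<nu> x - t 0)"
    using t(1) by (simp only: sums_Suc_iff diff_add_cancel)
  then have "(\<lambda>k. complex_of_real (t (Suc k))) sums of_real (struve_L \<nu> x - t 0)"
    by (rule sums_of_real)
  \<comment> \<open>The same complex series has been summed twice: as the Bessel expansion without
    its term of index 0, and by Abel summation as the outer integral.\<close>
  note series = sums_unique2 [OF this tail_sums]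
  \<comment> \<open>At k = 0 the denominator 1/2 contributes a factor 2, and 2 sqrt(x / (2 pi)) =
    sqrt(2 x / pi).\<close>
  have t_0: "t 0 = sqrt (2 * x / pi) * bessel_I (\<nu> + 1 / 2) x"
  proof -
    have "2 * x / pi = 4 * (x / (2 * pi))" by simp
    also have "sqrt \<dots> = 2 * sqrt (x / (2 * pi))" unfolding real_sqrt_mult by simp
    finally show ?thesis by (simp add: t_def)
  qed
  show ?thesis
  proof (intro conjI allI impI)
    show "interval_lebesgue_integrable lborel 0 (ereal (real_of_int \<lfloor>u\<rfloor>)) (frac_diff_op a)"
      if "u \<ge> 1" for u :: real
      by (rule inner [OF that])
    show "interval_lebesgue_integrable lborel 1 \<infinity> (\<lambda>u. of_real (g' u) * A u)"
      unfolding one_ereal_def interval_integrable_to_infinity_eq by (rule outer)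
    show "complex_of_real (struve_L \<nu> x - sqrt (2 * x / pi) * bessel_I (\<nu> + 1 / 2) x) =
        (LBINT u=1..\<infinity>. of_real (g' u) * A u)"
      unfolding one_ereal_def interval_integral_to_infinity_eq
      using series unfolding t_0 .
  qed
qed

end
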